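(* Let $\kappa\in\mathbb{Z}\setminus\{4\}$ and let $p>3$ be a prime with $\left(\frac{\kappa-4}{p}\right)=1$. Then $\mathcal{G}_\kappa(p)$ contains a subdivision of $K_{3,3}$.
   Context: $\kappa$ is regarded in $\mathbb{F}_p$; $\left(\frac{\cdot}{p}\right)$ is the Legendre symbol. $\mathcal{M}_\kappa(p)=\{(x,y,z)\in\mathbb{F}_p^3 : x^2+y^2+z^2=xyz+\kappa\}$; Vieta involutions $R_1(x,y,z)=(yz-x,y,z)$, $R_2(x,y,z)=(x,zx-y,z)$, $R_3(x,y,z)=(x,y,xy-z)$. $\mathcal{G}_\kappa(p)$ is the $3$-regular graph (possibly with loops) on $\mathcal{M}_\kappa(p)$ with an edge joining $X$ and $R_i(X)$ for each vertex $X$ and each $i$. *)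

theory Defs
  imports "Graph_Theory.Kuratowski" "HOL-Number_Theory.Number_Theory"
begin

text \<open>
  Elements of the field with \<open>p\<close> elements are represented by their least
  nonnegative residues, i.e. by the integers in \<open>{0..<p}\<close>.
\<close>

definition markoff_surface :: "int \<Rightarrow> int \<Rightarrow> (int \<times> int \<times> int) set" where
  "markoff_surface \<kappa> p =
     {(x, y, z). x \<in> {0..<p} \<and> y \<in> {0..<p} \<and> z \<in> {0..<p} \<and>
                 [x\<^sup>2 + y\<^sup>2 + z\<^sup>2 = x * y * z + \<kappa>] (mod p)}"

text \<open>Only the indices 1, 2, 3 are meant to be used.\<close>

definition vieta :: "int \<Rightarrow> nat \<Rightarrow> int \<times> int \<times> int \<Rightarrow> int \<times> int \<times> int" where
  "vieta p i = (\<lambda>(x, y, z).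
     if i = 1 then ((y * z - x) mod p, y, z)
     else if i = 2 then (x, (z * x - y) mod p, z)
     else (x, y, (x * y - z) mod p))"

text \<open>
  As usual in the library, an undirected graph is a symmetric digraph. The arc
  \<open>(X, i, Y)\<close> runs from \<open>X\<close> to \<open>Y\<close>; the label \<open>i\<close> keeps apart the loops at a point
  fixed by several involutions, so that the graph is 3-regular (a loop counts once).
  The edge joining \<open>X\<close> and \<open>Y = R\<^sub>i(X) \<noteq> X\<close> consists of the arcs \<open>(X, i, Y)\<close> and
  \<open>(Y, i, X)\<close>. The target is stored explicitly because the library's
  \<^const>\<open>subdivision\<close> relates graphs sharing the functions \<^const>\<open>tail\<close> and
  \<^const>\<open>head\<close>: arcs between non-neighbours of this graph have to exist in the arc type.
\<close>

definition markoff_graph ::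
  "int \<Rightarrow> int \<Rightarrow> (int \<times> int \<times> int, (int \<times> int \<times> int) \<times> nat \<times> (int \<times> int \<times> int)) pre_digraph" where
  "markoff_graph \<kappa> p =
     \<lparr> verts = markoff_surface \<kappa> p,
       arcs = {(X, i, Y). X \<in> markoff_surface \<kappa> p \<and> i \<in> {1, 2, 3} \<and> Y = vieta p i X},
       tail = (\<lambda>(X, i, Y). X),
       head = (\<lambda>(X, i, Y). Y) \<rparr>"

text \<open>The same notion of containment as in \<^const>\<open>kuratowski_planar\<close>.\<close>

definition contains_subdivision_K33 :: "('a, 'b) pre_digraph \<Rightarrow> bool" where
  "contains_subdivision_K33 G \<longleftrightarrow>
     (\<exists>H. subgraph H G \<and>
        (\<exists>K rev_K rev_H. subdivision (K, rev_K) (H, rev_H) \<and> K\<^bsub>3,3\<^esub> K))"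

lemma vieta_in_markoff_surface:
  assumes "p > 0" "X \<in> markoff_surface \<kappa> p"
  shows "vieta p i X \<in> markoff_surface \<kappa> p"
proof -
  have *: "[(b*c - a) mod p * ((b*c - a) mod p) + (b*b + c*c) = ((b*c - a) mod p) * (b*c) + \<kappa>] (mod p)"
    if "[a*a + (b*b + c*c) = a*(b*c) + \<kappa>] (mod p)" for a b c :: int
  proof -
    define d where "d = (b*c - a) mod p"
    have "[d = b*c - a] (mod p)" by (simp add: d_def cong_def)
    then have 1: "[d*d + (b*b + c*c) = (b*c-a)*(b*c-a) + (b*b+c*c)] (mod p)"
      and 2: "[d*(b*c) + \<kappa> = (b*c-a)*(b*c) + \<kappa>] (mod p)"
      by (auto intro!: cong_add cong_mult)
    have "[(b*c-a)*(b*c-a) + (b*b+c*c) = (b*c-a)*(b*c) + \<kappa>] (mod p)"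
      using that by (simp add: cong_iff_dvd_diff algebra_simps)
    with 1 2 show ?thesis unfolding d_def by (meson cong_sym cong_trans)
  qed
  obtain x y z where X: "X = (x, y, z)" by (cases X)
  have r: "x \<in> {0..<p}" "y \<in> {0..<p}" "z \<in> {0..<p}"
    and e: "[x*x + y*y + z*z = x*y*z + \<kappa>] (mod p)"
    using assms(2) by (simp_all add: X markoff_surface_def power2_eq_square)
  have m: "n mod p \<in> {0..<p}" for n using assms(1) by simp
  have 1: "vieta p i X \<in> markoff_surface \<kappa> p" if "i = 1"
    using *[of x y z] e r m[of "y*z - x"] that
    by (simp add: X markoff_surface_def vieta_def power2_eq_square algebra_simps)
  have 2: "vieta p i X \<in> markoff_surface \<kappa> p" if "i = 2"
    using *[of y z x] e r m[of "z*x - y"] that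
    by (simp add: X markoff_surface_def vieta_def power2_eq_square algebra_simps)
  have 3: "vieta p i X \<in> markoff_surface \<kappa> p" if "i \<noteq> 1" "i \<noteq> 2"
    using *[of z x y] e r m[of "x*y - z"] that
    by (simp add: X markoff_surface_def vieta_def power2_eq_square algebra_simps)
  from 1 2 3 show ?thesis by blast
qed

lemma vieta_vieta:
  assumes "X \<in> markoff_surface \<kappa> p"
  shows "vieta p i (vieta p i X) = X"
  using assms by (auto simp: markoff_surface_def vieta_def mod_diff_right_eq)

lemma pseudo_graph_markoff_graph:
  assumes "p > 0"
  shows "pseudo_graph (markoff_graph \<kappa> p)"
proof
  have fin: "finite (markoff_surface \<kappa> p)"
    by (rule finite_subset[of _ "{0..<p} \<times> {0..<p} \<times> {0..<p}"])
       (auto simp: markoff_surface_def)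
  then show "finite (verts (markoff_graph \<kappa> p))" by (simp add: markoff_graph_def)
  have "arcs (markoff_graph \<kappa> p) \<subseteq> markoff_surface \<kappa> p \<times> {1, 2, 3} \<times> markoff_surface \<kappa> p"
    using vieta_in_markoff_surface[OF assms] by (auto simp: markoff_graph_def)
  then show "finite (arcs (markoff_graph \<kappa> p))" by (rule finite_subset) (use fin in auto)
  show "symmetric (markoff_graph \<kappa> p)"
    unfolding symmetric_conv
  proof
    fix a assume "a \<in> arcs (markoff_graph \<kappa> p)"
    then obtain X i where a: "a = (X, i, vieta p i X)" "X \<in> markoff_surface \<kappa> p" "i \<in> {1, 2, 3}"
      by (auto simp: markoff_graph_def)
    show "\<exists>b \<in> arcs (markoff_graph \<kappa> p).
        tail (markoff_graph \<kappa> p) a = head (markoff_graph \<kappa> p) b \<and>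
        head (markoff_graph \<kappa> p) a = tail (markoff_graph \<kappa> p) b"
      by (rule bexI[of _ "(vieta p i X, i, X)"])
         (use a vieta_in_markoff_surface[OF assms] vieta_vieta[OF a(2)] in
           \<open>simp_all add: markoff_graph_def\<close>)
  qed
qed (use vieta_in_markoff_surface[OF assms] in \<open>auto simp: markoff_graph_def\<close>)

lemma markoff_graph_3_regular:
  assumes "X \<in> verts (markoff_graph \<kappa> p)"
  shows "out_degree (markoff_graph \<kappa> p) X = 3"
proof -
  have "out_arcs (markoff_graph \<kappa> p) X = (\<lambda>i. (X, i, vieta p i X)) ` {1, 2, 3}"
    using assms by (auto simp: markoff_graph_def out_arcs_def)
  then show ?thesis
    by (simp add: out_degree_def card_image inj_on_def)
qed

end

theory Submission
  imports Defs
begin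

text \<open>
  Choose \<open>d\<close> with \<open>d\<^sup>2 = \<kappa> - 4\<close>. The points of the surface with one coordinate equal to 2
  are those whose other two coordinates differ by \<open>d\<close>, up to sign; for a fixed position of the 2
  they form a single cycle of length \<open>2 p\<close>. Any two of the three cycles share one edge, which joins
  the points with two coordinates 2 and the third one \<open>2 + d\<close> or \<open>2 - d\<close>. Removing the two shared
  edges from a cycle leaves two paths of length \<open>p - 1\<close>, and as \<open>p - 1\<close> is even each of them
  joins a point with a coordinate \<open>2 + d\<close> to one with a coordinate \<open>2 - d\<close>. So the three
  points of the first kind and the three of the second kind are the branch vertices.
\<close>

section \<open>Subdividing undirected labelled graphs\<close>

definition arc_swap :: "'v \<times> 'l \<times> 'v \<Rightarrow> 'v \<times> 'l \<times> 'v" where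
  "arc_swap = (\<lambda>(u, l, v). (v, l, u))"

lemma arc_swap_simp [simp]: "arc_swap (u, l, v) = (v, l, u)"
  by (simp add: arc_swap_def)

text \<open>It suffices that \<open>S\<close> lists each undirected edge in one orientation. Since
  \<open>tail\<close> and \<open>head\<close> do not depend on \<open>S\<close>, all these graphs
  are \<open>compatible\<close> with each other.\<close>

definition edge_graph :: "('v \<times> 'l \<times> 'v) set \<Rightarrow> ('v, 'v \<times> 'l \<times> 'v) pre_digraph" where
  "edge_graph S =
     \<lparr> verts = fst ` S \<union> (snd \<circ> snd) ` S,
       arcs = S \<union> arc_swap ` S,
       tail = (\<lambda>(u, l, v). u),
       head = (\<lambda>(u, l, v). v) \<rparr>"

text \<open>The identity off the arcs, because the arcs of a \<open>bidirected_digraph\<close> are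
  exactly what its reversal moves.\<close>

definition edge_rev :: "('v \<times> 'l \<times> 'v) set \<Rightarrow> 'v \<times> 'l \<times> 'v \<Rightarrow> 'v \<times> 'l \<times> 'v" where
  "edge_rev S a = (if a \<in> arcs (edge_graph S) then arc_swap a else a)"

lemma edge_graph_simps [simp]:
  "tail (edge_graph S) = (\<lambda>(u, l, v). u)"
  "head (edge_graph S) = (\<lambda>(u, l, v). v)"
  "(u, l, v) \<in> arcs (edge_graph S) \<longleftrightarrow> (u, l, v) \<in> S \<or> (v, l, u) \<in> S"
  by (force simp: edge_graph_def)+

lemma wf_digraph_edge_graph: "wf_digraph (edge_graph S)"
  by unfold_locales (force simp: edge_graph_def)+

lemma bidirected_digraph_edge_graph:
  assumes "\<And>u l v. (u, l, v) \<in> S \<Longrightarrow> u \<noteq> v"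
  shows "bidirected_digraph (edge_graph S) (edge_rev S)"
proof -
  interpret wf_digraph "edge_graph S" by (rule wf_digraph_edge_graph)
  show ?thesis
  proof (rule bidirected_digraphI)
    fix a assume "a \<in> arcs (edge_graph S)"
    then obtain u l v where a: "a = (u, l, v)" "(u, l, v) \<in> S \<or> (v, l, u) \<in> S"
      by (cases a) simp
    then have "u \<noteq> v" using assms by blast
    then show "edge_rev S a \<noteq> a" "edge_rev S (edge_rev S a) = a"
      "tail (edge_graph S) (edge_rev S a) = head (edge_graph S) a"
      using a by (auto simp: edge_rev_def)
  qed (simp add: edge_rev_def)
qed

lemma subdivision_step_edge_graph:
  fixes i j k :: 'l and u v w :: 'a
  assumes loopfree: "\<And>x l y. (x, l, y) \<in> S \<Longrightarrow> x \<noteq> y" and "u \<noteq> v"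
    and new: "w \<notin> verts (edge_graph S)" "w \<noteq> u" "w \<noteq> v"
    and "(u, i, v) \<notin> S" "(v, i, u) \<notin> S"
  defines "G \<equiv> insert (u, i, v) S" and "H \<equiv> insert (u, j, w) (insert (w, k, v) S)"
  shows "subdivision_step (edge_graph G) (edge_rev G) (edge_graph H) (edge_rev H)
    (u, v, w) ((u, i, v), (u, j, w), (v, k, w))"
proof -
  have revs: "edge_rev G (u, i, v) = (v, i, u)" "edge_rev H (u, j, w) = (w, j, u)"
    "edge_rev H (v, k, w) = (w, k, v)"
    by (simp_all add: edge_rev_def G_def H_def)
  have G: "bidirected_digraph (edge_graph G) (edge_rev G)"
    by (rule bidirected_digraph_edge_graph) (use loopfree \<open>u \<noteq> v\<close> in \<open>auto simp: G_def\<close>)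
  have H: "bidirected_digraph (edge_graph H) (edge_rev H)"
    by (rule bidirected_digraph_edge_graph) (use loopfree new in \<open>auto simp: H_def\<close>)
  \<comment> \<open>Both sides swap the arcs common to the two graphs and fix everything
    else.\<close>
  have rev: "perm_restrict (edge_rev H) (arcs (edge_graph G)) =
      perm_restrict (edge_rev G) (arcs (edge_graph H))"
    by (simp add: fun_eq_iff perm_restrict_def edge_rev_def)
  have arcs: "arcs (edge_graph H) = {(u, j, w), (w, j, u), (v, k, w), (w, k, v)}
      \<union> arcs (edge_graph G) - {(u, i, v), (v, i, u)}"
  proof -
    \<comment> \<open>\<open>B\<close> is the common part, the arcs coming from \<open>S\<close>.
      The difference applies to the whole union, so the new arcs \<open>X\<close> must also avoid
      the removed arcs \<open>Y\<close>.\<close>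
    have "A = X \<union> C - Y" if "A = X \<union> B" "C = Y \<union> B" "X \<inter> Y = {}" "Y \<inter> B = {}"
      for A B C X Y :: "('a \<times> 'l \<times> 'a) set"
      using that by blast
    note * = this[of _ _ "arcs (edge_graph S)"]
    show ?thesis
    proof (rule *)
      show "{(u, i, v), (v, i, u)} \<inter> arcs (edge_graph S) = {}"
        using assms(6,7) by simp
      show "{(u, j, w), (w, j, u), (v, k, w), (w, k, v)} \<inter> {(u, i, v), (v, i, u)} = {}"
        using new(2,3) by auto
    qed (auto simp: edge_graph_def G_def H_def)
  qed
  have verts: "verts (edge_graph H) = verts (edge_graph G) \<union> {w}" "w \<notin> verts (edge_graph G)"
    using new by (auto simp: edge_graph_def G_def H_def)
  show ?thesis
    unfolding subdivision_step_def prod.case revs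
  proof (intro conjI G H rev arcs verts)
    show "distinct [(u, j, w), (w, j, u), (v, k, w), (w, k, v)]"
      using \<open>u \<noteq> v\<close> new(2,3) by simp
  qed (simp_all add: compatible_def arc_to_ends_def G_def)
qed

section \<open>Replacing edges by paths\<close>

abbreviation path_arcs :: "(nat \<Rightarrow> 'v) \<Rightarrow> (nat \<Rightarrow> 'l) \<Rightarrow> nat \<Rightarrow> ('v \<times> 'l \<times> 'v) set" where
  "path_arcs f l n \<equiv> (\<lambda>k. (f k, l k, f (Suc k))) ` {..<n}"

text \<open>The closing arc bears the label of the last arc of the path, so that a path of length 1
  stands for itself.\<close>

lemma subdivision_path:
  assumes loopfree: "\<And>x i y. (x, i, y) \<in> S \<Longrightarrow> x \<noteq> y"
    and inj: "inj_on f {..n}" and "n > 0"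
    and new: "\<And>k. 0 < k \<Longrightarrow> k < n \<Longrightarrow> f k \<notin> verts (edge_graph S)"
    and "(f 0, l (n - 1), f n) \<notin> S" "(f n, l (n - 1), f 0) \<notin> S"
  defines "G \<equiv> insert (f 0, l (n - 1), f n) S" and "H \<equiv> path_arcs f l n \<union> S"
  shows "subdivision (edge_graph G, edge_rev G) (edge_graph H, edge_rev H)"
proof -
  define T where "T m = path_arcs f l m \<union> S" for m
  \<comment> \<open>The first \<open>m\<close> edges of the path are drawn and one edge to
    \<open>f n\<close> stands for the rest. For \<open>m = n - 1\<close> this edge is the last edge
    of the path, label included, so the induction stops there.\<close>
  define I where "I m = insert (f m, l (n - 1), f n) (T m)" for m
  have f: "f k = f k' \<longleftrightarrow> k = k'" if "k \<le> n" "k' \<le> n" for k k'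
    using inj that by (auto simp: inj_on_def)
  have "subdivision (edge_graph G, edge_rev G) (edge_graph (I m), edge_rev (I m))" if "m < n" for m
    using that
  proof (induction m)
    case 0
    have "I 0 = G" by (simp add: I_def T_def G_def)
    moreover have "bidirected_digraph (edge_graph G) (edge_rev G)"
      using loopfree f[of 0 n] \<open>n > 0\<close> by (intro bidirected_digraph_edge_graph) (auto simp: G_def)
    ultimately show ?case by (simp add: subdivision_base)
  next
    case (Suc m)
    have S: "f k \<noteq> x" "f k \<noteq> y" if "(x, i, y) \<in> S" "0 < k" "k < n" for x i y k
      using new[OF that(2,3)] that(1) by (force simp: edge_graph_def)+
    have lf: "x \<noteq> y" if "(x, i, y) \<in> T m" for x i y
      using that loopfree Suc.prems by (auto simp: T_def f)
    have "verts (edge_graph (T m)) \<subseteq> f ` {..m} \<union> verts (edge_graph S)"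
      by (auto simp: T_def edge_graph_def)
    moreover have "f (Suc m) \<notin> f ` {..m}"
    proof
      assume "f (Suc m) \<in> f ` {..m}"
      then obtain k where "f (Suc m) = f k" "k \<le> m" by auto
      then show False using f[of "Suc m" k] Suc.prems by simp
    qed
    ultimately have new': "f (Suc m) \<notin> verts (edge_graph (T m))"
      using new[of "Suc m"] Suc.prems by blast
    have "f n \<noteq> f k" "f n \<noteq> f (Suc k)" if "k < m" for k
      using f[of n k] f[of n "Suc k"] that Suc.prems by auto
    then have "(f m, l (n - 1), f n) \<notin> path_arcs f l m" "(f n, l (n - 1), f m) \<notin> path_arcs f l m"
      by auto
    \<comment> \<open>For \<open>m > 0\<close> the vertex \<open>f m\<close> is interior to the path
      and meets no arc of \<open>S\<close>; for \<open>m = 0\<close> the claim about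
      \<open>S\<close> is a hypothesis.\<close>
    then have not_T: "(f m, l (n - 1), f n) \<notin> T m" "(f n, l (n - 1), f m) \<notin> T m"
      using S(1)[of "f m" _ "f n" m] S(2)[of "f n" _ "f m" m] assms(5,6) Suc.prems
      by (cases "m = 0"; auto simp: T_def)+
    have "subdivision_step (edge_graph (I m)) (edge_rev (I m))
      (edge_graph (insert (f m, l m, f (Suc m)) (insert (f (Suc m), l (n - 1), f n) (T m))))
      (edge_rev (insert (f m, l m, f (Suc m)) (insert (f (Suc m), l (n - 1), f n) (T m))))
      (f m, f n, f (Suc m)) ((f m, l (n - 1), f n), (f m, l m, f (Suc m)), (f n, l (n - 1), f (Suc m)))"
      unfolding I_def
    proof (rule subdivision_step_edge_graph)
      show "x \<noteq> y" if "(x, i, y) \<in> T m" for x i y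
        using lf[OF that] .
    qed (use new' not_T f[of m n] f[of "Suc m" n] f[of m "Suc m"] Suc.prems in auto)
    moreover have "insert (f m, l m, f (Suc m)) (insert (f (Suc m), l (n - 1), f n) (T m)) = I (Suc m)"
      by (auto simp: I_def T_def lessThan_Suc)
    ultimately show ?case
      using Suc by (auto intro: subdivision.divide)
  qed
  from this[of "n - 1"] have "subdivision (edge_graph G, edge_rev G) (edge_graph (I (n - 1)), edge_rev (I (n - 1)))"
    using \<open>n > 0\<close> by simp
  moreover have "I (n - 1) = H"
    using \<open>n > 0\<close> by (cases n) (auto simp: I_def T_def H_def lessThan_Suc)
  ultimately show ?thesis by simp
qed

text \<open>The edges are replaced one at a time. By \<open>inner\<close>, the interior vertices of
  a path are still fresh when its turn comes; by \<open>ends\<close>, the edge to be replaced is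
  never parallel to another one.\<close>

lemma subdivision_paths:
  fixes f :: "'e \<Rightarrow> nat \<Rightarrow> 'v" and l :: "'e \<Rightarrow> nat \<Rightarrow> 'l" and n :: "'e \<Rightarrow> nat"
  assumes "finite I"
    and pos: "\<And>e. e \<in> I \<Longrightarrow> n e > 0"
    and inj: "\<And>e. e \<in> I \<Longrightarrow> inj_on (f e) {..n e}"
    and inner: "\<And>e e' k k'. e \<in> I \<Longrightarrow> e' \<in> I \<Longrightarrow> 0 < k \<Longrightarrow> k < n e \<Longrightarrow> k' \<le> n e' \<Longrightarrow>
      f e k = f e' k' \<Longrightarrow> e = e'"
    and ends: "\<And>e e'. e \<in> I \<Longrightarrow> e' \<in> I \<Longrightarrow> {f e 0, f e (n e)} = {f e' 0, f e' (n e')} \<Longrightarrow> e = e'"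
  defines "G \<equiv> (\<lambda>e. (f e 0, l e (n e - 1), f e (n e))) ` I"
    and "H \<equiv> \<Union>e\<in>I. path_arcs (f e) (l e) (n e)"
  shows "subdivision (edge_graph G, edge_rev G) (edge_graph H, edge_rev H)"
proof -
  define A where "A e = (f e 0, l e (n e - 1), f e (n e))" for e
  define W where "W e = path_arcs (f e) (l e) (n e)" for e
  \<comment> \<open>\<open>J\<close> is the set of edges already replaced by their paths; the others
    are still single edges.\<close>
  define M where "M J = A ` (I - J) \<union> \<Union> (W ` J)" for J
  have inj': "f e k = f e k' \<longleftrightarrow> k = k'" if "e \<in> I" "k \<le> n e" "k' \<le> n e" for e k k'
    using inj[OF that(1)] that by (auto simp: inj_on_def)
  have "subdivision (edge_graph G, edge_rev G) (edge_graph (M J), edge_rev (M J))" if "J \<subseteq> I" for J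
    using finite_subset[OF that \<open>finite I\<close>] that
  proof (induction J)
    case empty
    have "M {} = G" by (simp add: M_def A_def G_def)
    moreover have "bidirected_digraph (edge_graph G) (edge_rev G)"
      using inj' pos by (intro bidirected_digraph_edge_graph) (force simp: G_def)
    ultimately show ?case by (simp add: subdivision_base)
  next
    case (insert e J)
    then have e: "e \<in> I" "e \<notin> J" and J: "J \<subseteq> I" by auto
    define S where "S = A ` (I - insert e J) \<union> \<Union> (W ` J)"
    \<comment> \<open>Replaced and unreplaced edges are treated uniformly: an arc of
      \<open>S\<close> joins two vertices of some other path \<open>e'\<close>, either consecutive
      ones or the two ends.\<close>
    have S_E: "\<exists>e' k k'. e' \<in> I \<and> e' \<noteq> e \<and> x = f e' k \<and> y = f e' k' \<and> k < k' \<and> k' \<le> n e' \<and>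
      (k' = Suc k \<or> k = 0 \<and> k' = n e')"
      if xiy: "(x, i, y) \<in> S" for x i y
    proof -
      consider e' where "e' \<in> I" "e' \<noteq> e" "(x, i, y) = A e'"
        | e' k where "e' \<in> I" "e' \<noteq> e" "k < n e'" "(x, i, y) = (f e' k, l e' k, f e' (Suc k))"
        using xiy e J by (auto simp: S_def W_def)
      then show ?thesis
      proof cases
        case 1
        then show ?thesis
          using pos[of e'] by (intro exI[of _ e'] exI[of _ 0] exI[of _ "n e'"]) (auto simp: A_def)
      next
        case 2
        then show ?thesis
          by (intro exI[of _ e'] exI[of _ k] exI[of _ "Suc k"]) auto
      qed
    qed
    \<comment> \<open>If an arc along \<open>e'\<close> had the ends of \<open>e\<close>, neither of
      its vertices could be interior to \<open>e'\<close>, so they would be the two ends of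
      \<open>e'\<close>, against \<open>ends\<close>.\<close>
    have disj: False
      if "e' \<in> I" "e' \<noteq> e" "k < k'" "k' \<le> n e'" "k' = Suc k \<or> k = 0 \<and> k' = n e'"
        "{f e 0, f e (n e)} = {f e' k, f e' k'}" for e' k k'
    proof -
      have *: "f e' m \<notin> {f e 0, f e (n e)}" if "0 < m" "m < n e'" for m
        using inner[of e' e m 0] inner[of e' e m "n e"] that \<open>e' \<in> I\<close> \<open>e' \<noteq> e\<close> e by auto
      have "f e' k \<in> {f e 0, f e (n e)}" "f e' k' \<in> {f e 0, f e (n e)}"
        using that(6) by simp_all
      then have "\<not> (0 < k \<and> k < n e')" "\<not> (0 < k' \<and> k' < n e')"
        using *[of k] *[of k'] by blast+
      then have "k = 0" "k' = n e'"
        using that(3,4) by linarith+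
      then show False using ends[of e e'] that e by simp
    qed
    have "subdivision (edge_graph (insert (A e) S), edge_rev (insert (A e) S))
      (edge_graph (W e \<union> S), edge_rev (W e \<union> S))"
      unfolding A_def W_def
    proof (rule subdivision_path)
      show "x \<noteq> y" if "(x, i, y) \<in> S" for x i y
        using S_E[OF that] inj' by (metis less_imp_le less_irrefl order_trans)
      show "f e k \<notin> verts (edge_graph S)" if "0 < k" "k < n e" for k
      proof
        assume "f e k \<in> verts (edge_graph S)"
        then obtain x i y where "(x, i, y) \<in> S" "f e k = x \<or> f e k = y"
          by (auto simp: edge_graph_def)
        then obtain e' k' where "e' \<in> I" "e' \<noteq> e" "k' \<le> n e'" "f e k = f e' k'"
          using S_E[of x i y] by (metis less_imp_le order_trans)
        then show False using inner[of e e' k k'] that e by auto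
      qed
      show "(f e 0, l e (n e - 1), f e (n e)) \<notin> S"
      proof
        assume "(f e 0, l e (n e - 1), f e (n e)) \<in> S"
        from S_E[OF this] obtain e' k k' where "e' \<in> I" "e' \<noteq> e" "k < k'" "k' \<le> n e'"
          "k' = Suc k \<or> k = 0 \<and> k' = n e'" "f e 0 = f e' k" "f e (n e) = f e' k'" by blast
        then show False by (intro disj[of e' k k']) auto
      qed
      show "(f e (n e), l e (n e - 1), f e 0) \<notin> S"
      proof
        assume "(f e (n e), l e (n e - 1), f e 0) \<in> S"
        from S_E[OF this] obtain e' k k' where "e' \<in> I" "e' \<noteq> e" "k < k'" "k' \<le> n e'"
          "k' = Suc k \<or> k = 0 \<and> k' = n e'" "f e (n e) = f e' k" "f e 0 = f e' k'" by blast
        then show False by (intro disj[of e' k k']) auto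
      qed
    qed (use inj pos e in auto)
    moreover have "insert (A e) S = M J" "W e \<union> S = M (insert e J)"
      using e by (auto simp: S_def M_def)
    ultimately show ?case
      using insert.IH[OF J] by (auto intro: subdivision_trans)
  qed
  from this[of I] show ?thesis by (simp add: M_def W_def H_def)
qed

section \<open>Recognizing a subdivision of K33\<close>

lemma K33_edge_graph:
  assumes X: "card X = 3" "inj_on a X" and Y: "card Y = 3" "inj_on b Y"
    and disj: "a ` X \<inter> b ` Y = {}"
  shows "K\<^bsub>3,3\<^esub> (edge_graph ((\<lambda>(i, j). (a i, l i j, b j)) ` (X \<times> Y)))"
proof -
  define S where "S = (\<lambda>(i, j). (a i, l i j, b j)) ` (X \<times> Y)"
  have fin: "finite X" "finite Y"
    using X Y by (simp_all add: card_ge_0_finite)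
  then have ne: "X \<noteq> {}" "Y \<noteq> {}"
    using X Y by auto
  have S_iff: "(u, k, v) \<in> S \<longleftrightarrow> (\<exists>i\<in>X. \<exists>j\<in>Y. u = a i \<and> k = l i j \<and> v = b j)" for u k v
    by (auto simp: S_def)
  have ab: "a i \<noteq> b j" if "i \<in> X" "j \<in> Y" for i j
    using disj that by blast
  have verts: "verts (edge_graph S) = a ` X \<union> b ` Y"
    using ne by (force simp: edge_graph_def S_def)
  have ends: "arcs_ends (edge_graph S) = a ` X \<times> b ` Y \<union> b ` Y \<times> a ` X"
  proof -
    have "(u, v) \<in> arcs_ends (edge_graph S) \<longleftrightarrow> (\<exists>k. (u, k, v) \<in> arcs (edge_graph S))" for u v
    proof
      assume "(u, v) \<in> arcs_ends (edge_graph S)"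
      then show "\<exists>k. (u, k, v) \<in> arcs (edge_graph S)"
        by (rule reachableE) (simp add: split_paired_all split_def, metis prod.collapse)
    next
      assume "\<exists>k. (u, k, v) \<in> arcs (edge_graph S)"
      then obtain k where "(u, k, v) \<in> arcs (edge_graph S)" ..
      then show "(u, v) \<in> arcs_ends (edge_graph S)"
        unfolding arcs_ends_conv by (rule rev_image_eqI) simp
    qed
    moreover have "(\<exists>k. (u, k, v) \<in> S) \<longleftrightarrow> u \<in> a ` X \<and> v \<in> b ` Y" for u v
      by (auto simp: S_iff)
    ultimately have "(u, v) \<in> arcs_ends (edge_graph S) \<longleftrightarrow>
        (u, v) \<in> a ` X \<times> b ` Y \<union> b ` Y \<times> a ` X" for u v
      by (simp only: edge_graph_simps ex_disj_distrib mem_Times_iff Un_iff fst_conv snd_conv) blast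
    then show ?thesis
      by (intro equalityI subrelI) blast+
  qed
  interpret wf_digraph "edge_graph S" by (rule wf_digraph_edge_graph)
  have "graph (edge_graph S)"
  proof unfold_locales
    show "finite (verts (edge_graph S))"
      using fin by (simp add: verts)
    show "finite (arcs (edge_graph S))"
      using fin by (simp add: edge_graph_def S_def)
    show "symmetric (edge_graph S)"
      unfolding symmetric_def ends by (auto simp: sym_def)
    show "tail (edge_graph S) e \<noteq> head (edge_graph S) e" if "e \<in> arcs (edge_graph S)" for e
      using that ab by (cases e) (fastforce simp: S_iff)
    \<comment> \<open>No parallel arcs: injectivity of \<open>a\<close> and \<open>b\<close> makes
      the ends determine the indices, hence the label, and disjointness of the two sides rules out a
      clash between opposite orientations.\<close>
    show "e = e'" if arcs: "e \<in> arcs (edge_graph S)" "e' \<in> arcs (edge_graph S)"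
      and same_ends: "arc_to_ends (edge_graph S) e = arc_to_ends (edge_graph S) e'" for e e'
    proof -
      obtain u k v where e: "e = (u, k, v)" by (cases e)
      obtain k' where e': "e' = (u, k', v)"
        using same_ends by (cases e') (simp add: e arc_to_ends_def)
      have same: "k = k'" if "(x, k, y) \<in> S" "(x, k', y) \<in> S" for x y
        using that X(2) Y(2) by (auto simp: S_iff dest: inj_onD)
      have opp: False if "(x, k, y) \<in> S" "(y, k', x) \<in> S" for x y
        using that ab by (auto simp: S_iff)
      have opp': False if "(x, k', y) \<in> S" "(y, k, x) \<in> S" for x y
        using that ab by (auto simp: S_iff)
      from arcs have "k = k'"
        unfolding e e' edge_graph_simps using same opp opp' by blast
      then show ?thesis by (simp add: e e')
    qed
  qed
  moreover have "card (a ` X) = 3" "card (b ` Y) = 3"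
    using X Y by (simp_all add: card_image)
  ultimately show ?thesis
    unfolding complete_bipartite_digraph_def S_def[symmetric]
    using verts ends disj by blast
qed

text \<open>Reduces containment to nine internally disjoint paths from the \<open>a i\<close> to the
  \<open>b j\<close>. Each step must be an arc of \<open>G\<close> in both directions, as undirected
  edges are pairs of arcs.\<close>

lemma contains_subdivision_K33I:
  fixes G :: "('v, 'v \<times> 'l \<times> 'v) pre_digraph"
    and f :: "'i \<times> 'j \<Rightarrow> nat \<Rightarrow> 'v" and l :: "'i \<times> 'j \<Rightarrow> nat \<Rightarrow> 'l"
  assumes wf: "wf_digraph G"
    and tail: "tail G = (\<lambda>(u, l, v). u)" and head: "head G = (\<lambda>(u, l, v). v)"
    and X: "card X = 3" "inj_on a X" and Y: "card Y = 3" "inj_on b Y"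
    and disj: "a ` X \<inter> b ` Y = {}"
    and ends: "\<And>i j. i \<in> X \<Longrightarrow> j \<in> Y \<Longrightarrow> f (i, j) 0 = a i"
      "\<And>i j. i \<in> X \<Longrightarrow> j \<in> Y \<Longrightarrow> f (i, j) (n (i, j)) = b j"
    and inj: "\<And>e. e \<in> X \<times> Y \<Longrightarrow> inj_on (f e) {..n e}"
    and inner: "\<And>e e' k k'. e \<in> X \<times> Y \<Longrightarrow> e' \<in> X \<times> Y \<Longrightarrow> 0 < k \<Longrightarrow> k < n e \<Longrightarrow> k' \<le> n e' \<Longrightarrow>
      f e k = f e' k' \<Longrightarrow> e = e'"
    and arcs: "\<And>e k. e \<in> X \<times> Y \<Longrightarrow> k < n e \<Longrightarrow> (f e k, l e k, f e (Suc k)) \<in> arcs G"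
      "\<And>e k. e \<in> X \<times> Y \<Longrightarrow> k < n e \<Longrightarrow> (f e (Suc k), l e k, f e k) \<in> arcs G"
  shows "contains_subdivision_K33 G"
proof -
  define S where "S = (\<lambda>e. (f e 0, l e (n e - 1), f e (n e))) ` (X \<times> Y)"
  define T where "T = (\<Union>e\<in>X \<times> Y. path_arcs (f e) (l e) (n e))"
  have ab: "a i \<noteq> b j" if "i \<in> X" "j \<in> Y" for i j
    using disj that by blast
  have "S = (\<lambda>(i, j). (a i, l (i, j) (n (i, j) - 1), b j)) ` (X \<times> Y)"
    unfolding S_def by (rule image_cong) (auto simp: ends)
  then have K33: "K\<^bsub>3,3\<^esub> (edge_graph S)"
    using K33_edge_graph[OF X Y disj, of "\<lambda>i j. l (i, j) (n (i, j) - 1)"] by simp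
  have sub: "subdivision (edge_graph S, edge_rev S) (edge_graph T, edge_rev T)"
    unfolding S_def T_def
  proof (rule subdivision_paths)
    show "finite (X \<times> Y)"
      using X Y by (simp add: card_ge_0_finite)
    show "n e > 0" if e: "e \<in> X \<times> Y" for e
    proof (rule ccontr)
      assume "\<not> n e > 0"
      then show False
        using e ends[of "fst e" "snd e"] ab[of "fst e" "snd e"] by auto
    qed
    show "e = e'" if ee': "e \<in> X \<times> Y" "e' \<in> X \<times> Y" "{f e 0, f e (n e)} = {f e' 0, f e' (n e')}" for e e'
    proof -
      obtain i j i' j' where e: "e = (i, j)" "e' = (i', j')" "i \<in> X" "j \<in> Y" "i' \<in> X" "j' \<in> Y"
        using ee'(1,2) by auto
      have "{a i, b j} = {a i', b j'}"
        using ee'(3) e by (simp add: ends)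
      then have "a i = a i'" "b j = b j'"
        using ab[of i j'] ab[of i' j] e by (auto simp: doubleton_eq_iff)
      then show ?thesis
        using e inj_onD[OF X(2)] inj_onD[OF Y(2)] by simp
    qed
  qed (fact inj inner)+
  have T_G: "arcs (edge_graph T) \<subseteq> arcs G"
    using arcs by (auto simp: edge_graph_def T_def)
  interpret wf_digraph G by fact
  have "subgraph (edge_graph T) G"
    unfolding subgraph_def
  proof (intro conjI T_G wf wf_digraph_edge_graph)
    show "verts (edge_graph T) \<subseteq> verts G"
    proof
      fix x assume "x \<in> verts (edge_graph T)"
      then obtain u k v where "(u, k, v) \<in> T" "x = u \<or> x = v"
        by (auto simp: edge_graph_def)
      moreover have "(u, k, v) \<in> arcs G"
        using T_G \<open>(u, k, v) \<in> T\<close> by (auto simp: edge_graph_def)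
      ultimately show "x \<in> verts G"
        using tail_in_verts head_in_verts by (fastforce simp: tail head)
    qed
  qed (simp add: compatible_def tail head)
  with sub K33 show ?thesis
    unfolding contains_subdivision_K33_def by blast
qed

section \<open>The three cycles\<close>

text \<open>Coordinates are measured from 2 in units of \<open>d\<close>. Where one height is 0, the
  surface equation and the involutions become affine conditions on the other two heights.\<close>

definition surface_point :: "int \<Rightarrow> int \<Rightarrow> (nat \<Rightarrow> int) \<Rightarrow> int \<times> int \<times> int" where
  "surface_point p d h = ((2 + d * h 1) mod p, (2 + d * h 2) mod p, (2 + d * h 3) mod p)"

lemma surface_point_eq_iff:
  assumes "prime p" "\<not> p dvd d"
  shows "surface_point p d g = surface_point p d h \<longleftrightarrow> (\<forall>c\<in>{1, 2, 3}. p dvd g c - h c)"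
proof -
  have "(2 + d * x) mod p = (2 + d * y) mod p \<longleftrightarrow> p dvd x - y" for x y
  proof -
    have "(2 + d * x) mod p = (2 + d * y) mod p \<longleftrightarrow> p dvd d * (x - y)"
      by (simp add: mod_eq_dvd_iff right_diff_distrib)
    then show ?thesis
      using assms by (simp add: prime_dvd_mult_iff)
  qed
  then show ?thesis
    unfolding surface_point_def prod.inject by simp
qed

text \<open>Once one coordinate is 2, the equation says that the square of the difference of the
  other two is \<open>\<kappa> - 4\<close>.\<close>

lemma surface_point_in_markoff_surface:
  assumes "p > 0" and \<kappa>: "[d\<^sup>2 = \<kappa> - 4] (mod p)"
    and ijk: "{i, j, k} \<subseteq> {1, 2, 3}" "distinct [i, j, k]" and h: "h k = 0" "(h i - h j)\<^sup>2 = 1"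
  shows "surface_point p d h \<in> markoff_surface \<kappa> p"
proof -
  define x y z where "x = 2 + d * h 1" and "y = 2 + d * h 2" and "z = 2 + d * h 3"
  have perm: "(i, j, k) \<in> {(1, 2, 3), (1, 3, 2), (2, 1, 3), (2, 3, 1), (3, 1, 2), (3, 2, 1)}"
    using ijk by auto
  have "x\<^sup>2 + y\<^sup>2 + z\<^sup>2 - (x * y * z + \<kappa>) = d\<^sup>2 * (h i - h j)\<^sup>2 - (\<kappa> - 4)"
    using perm h(1) unfolding x_def y_def z_def
    by (elim insertE) (simp_all add: power2_eq_square algebra_simps)
  also have "\<dots> = d\<^sup>2 - (\<kappa> - 4)"
    using h(2) by simp
  finally have "[x\<^sup>2 + y\<^sup>2 + z\<^sup>2 = x * y * z + \<kappa>] (mod p)"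
    using \<kappa> by (simp only: cong_iff_dvd_diff)
  moreover have "[(x mod p)\<^sup>2 + (y mod p)\<^sup>2 + (z mod p)\<^sup>2 = x\<^sup>2 + y\<^sup>2 + z\<^sup>2] (mod p)"
    "[(x mod p) * (y mod p) * (z mod p) + \<kappa> = x * y * z + \<kappa>] (mod p)"
    by (intro cong_add cong_mult cong_pow; simp add: cong_def)+
  ultimately have "[(x mod p)\<^sup>2 + (y mod p)\<^sup>2 + (z mod p)\<^sup>2 = (x mod p) * (y mod p) * (z mod p) + \<kappa>] (mod p)"
    by (meson cong_sym cong_trans)
  then show ?thesis
    using \<open>p > 0\<close> by (simp add: markoff_surface_def surface_point_def x_def y_def z_def)
qed

text \<open>With a third coordinate 2, the involution sends \<open>x\<close> to
  \<open>2 * y - x\<close>, which reflects the height of \<open>x\<close> in that of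
  \<open>y\<close>.\<close>

lemma vieta_surface_point:
  assumes ijk: "{i, j, k} \<subseteq> {1, 2, 3}" "distinct [i, j, k]" and h: "h k = 0"
  shows "vieta p j (surface_point p d h) = surface_point p d (h(j := 2 * h i - h j))"
proof -
  \<comment> \<open>Both orders of the factors are covered, since \<open>vieta\<close> multiplies
    the coordinates in cyclic order.\<close>
  have *: "((2 + d * u) mod p * (2 mod p) - (2 + d * v) mod p) mod p = (2 + d * (2 * u - v)) mod p"
    "((2 mod p) * ((2 + d * u) mod p) - (2 + d * v) mod p) mod p = (2 + d * (2 * u - v)) mod p" for u v
  proof -
    have "[(2 + d * u) mod p * (2 mod p) - (2 + d * v) mod p = (2 + d * u) * 2 - (2 + d * v)] (mod p)"
      by (intro cong_diff cong_mult; simp add: cong_def)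
    then show "((2 + d * u) mod p * (2 mod p) - (2 + d * v) mod p) mod p = (2 + d * (2 * u - v)) mod p"
      by (simp add: cong_def algebra_simps)
    then show "((2 mod p) * ((2 + d * u) mod p) - (2 + d * v) mod p) mod p = (2 + d * (2 * u - v)) mod p"
      by (simp only: mult.commute)
  qed
  have "(i, j, k) \<in> {(1, 2, 3), (1, 3, 2), (2, 1, 3), (2, 3, 1), (3, 1, 2), (3, 2, 1)}"
    using ijk by auto
  then show ?thesis
    using h by (elim insertE) (simp_all add: surface_point_def vieta_def *)
qed

section \<open>The nine paths in terms of heights\<close>

text \<open>
  The \<open>m\<close>-th vertex on the path from the branch vertex \<open>2 + d\<close> at position \<open>i\<close> to the branch
  vertex \<open>2 - d\<close> at position \<open>j\<close>. For \<open>i \<noteq> j\<close> the involutions at \<open>j\<close> and \<open>i\<close> are applied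
  alternately; for \<open>i = j\<close> the path is a single edge.
\<close>

definition offset :: "nat \<Rightarrow> nat \<Rightarrow> nat \<Rightarrow> nat \<Rightarrow> int" where
  "offset i j m c =
     (if i = j then if c = i then if m = 0 then 1 else -1 else 0
      else if c = i then if even m then int m + 1 else int m
      else if c = j then if even m then int m else int m + 1
      else 0)"

lemma third_index:
  assumes "i \<in> {1, 2, 3 :: nat}" "j \<in> {1, 2, 3}" "i \<noteq> j"
  obtains k where "{i, j, k} \<subseteq> {1, 2, 3}" "distinct [i, j, k]"
proof -
  obtain k where "k \<in> {1, 2, 3}" "k \<noteq> i" "k \<noteq> j"
    using assms by fastforce
  then show ?thesis
    using assms by (intro that[of k]) simp_all
qed

text \<open>For \<open>i \<noteq> j\<close> the heights are \<open>m\<close> and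
  \<open>m + 1\<close>, the odd one at \<open>i\<close> and the even one at \<open>j\<close>.
  Reflecting the smaller in the larger gives \<open>m + 2\<close>, and the smaller one is at
  \<open>j\<close> exactly when \<open>m\<close> is even.\<close>

lemma vieta_offset:
  assumes "i \<in> {1, 2, 3}" "j \<in> {1, 2, 3}" "i = j \<Longrightarrow> m = 0"
  shows "vieta p (if even m then j else i) (surface_point p d (offset i j m)) =
    surface_point p d (offset i j (Suc m))"
proof (cases "i = j")
  case True
  \<comment> \<open>Any other position has height 0, and reflection in 0 turns the height 1 into
    -1.\<close>
  have "\<exists>i'\<in>{1, 2, 3 :: nat}. i' \<noteq> i"
    by auto
  then obtain i' where i': "i' \<in> {1, 2, 3}" "i' \<noteq> i"
    by blast
  then obtain k where k: "{i', i, k} \<subseteq> {1, 2, 3}" "distinct [i', i, k]"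
    using third_index[of i' i] assms(1) by metis
  have "(offset i j m)(j := 2 * offset i j m i' - offset i j m j) = offset i j (Suc m)"
    using True assms(3) \<open>i' \<noteq> i\<close> by (auto simp: offset_def)
  then show ?thesis
    using vieta_surface_point[OF k, of "offset i j m" p d] True assms(3) k by (simp add: offset_def)
next
  case False
  then obtain k where k: "{i, j, k} \<subseteq> {1, 2, 3}" "distinct [i, j, k]"
    using third_index assms(1,2) by metis
  then have k': "{j, i, k} \<subseteq> {1, 2, 3}" "distinct [j, i, k]" "offset i j m k = 0"
    by (auto simp: insert_commute offset_def)
  show ?thesis
  proof (cases "even m")
    case True
    then have "(offset i j m)(j := 2 * offset i j m i - offset i j m j) = offset i j (Suc m)"
      using False by (auto simp: offset_def)
    then show ?thesis
      using vieta_surface_point[OF k, of "offset i j m" p d] k'(3) True by simp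
  next
    case odd: False
    then have "(offset i j m)(i := 2 * offset i j m j - offset i j m i) = offset i j (Suc m)"
      using False by (auto simp: offset_def)
    then show ?thesis
      using vieta_surface_point[OF k'(1,2), of "offset i j m" p d] k'(3) odd by simp
  qed
qed

lemma offset_in_markoff_surface:
  assumes "p > 0" "[d\<^sup>2 = \<kappa> - 4] (mod p)" "i \<in> {1, 2, 3}" "j \<in> {1, 2, 3}"
  shows "surface_point p d (offset i j m) \<in> markoff_surface \<kappa> p"
proof -
  \<comment> \<open>\<open>i'\<close> is a position whose height differs by 1 from that at
    \<open>i\<close>: \<open>j\<close> itself, or any other position if
    \<open>i = j\<close>.\<close>
  have "\<exists>i'\<in>{1, 2, 3}. i' \<noteq> i \<and> (i \<noteq> j \<longrightarrow> i' = j)"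
    using assms(3,4) by auto
  then obtain i' where i': "i' \<in> {1, 2, 3}" "i' \<noteq> i" "i \<noteq> j \<longrightarrow> i' = j"
    by blast
  then obtain k where k: "{i, i', k} \<subseteq> {1, 2, 3}" "distinct [i, i', k]"
    using third_index[of i i'] assms(3) by metis
  show ?thesis
    using i' k by (intro surface_point_in_markoff_surface[OF assms(1,2) k]) (auto simp: offset_def)
qed

section \<open>Disjointness of the paths by congruences\<close>

lemma small_dvd_eq:
  assumes "p dvd int m - int m'" "int m < p" "int m' < p"
  shows "m = m'"
proof -
  have "int m mod p = int m' mod p"
    using assms(1) by (simp add: mod_eq_dvd_iff)
  then show ?thesis
    using assms(2,3) by simp
qed

text \<open>For \<open>i \<noteq> j\<close> the height at \<open>i\<close> minus that at
  \<open>j\<close> is 1 or -1 according to the parity of \<open>m\<close>. Different parities would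
  make \<open>p\<close> divide 2; with equal parities the heights at \<open>i\<close> differ by
  \<open>m - m'\<close>.\<close>

lemma offset_cong_same:
  assumes "p > 2" "int m < p" "int m' < p" "i = j \<Longrightarrow> m \<le> 1 \<and> m' \<le> 1"
    and cong: "\<And>c. c \<in> {i, j} \<Longrightarrow> p dvd offset i j m c - offset i j m' c"
  shows "m = m'"
proof (rule ccontr)
  assume ne: "m \<noteq> m'"
  have 2: "\<not> p dvd 2"
    using \<open>p > 2\<close> zdvd_not_zless[of 2 p] by simp
  show False
  proof (cases "i = j")
    case True
    then have "p dvd 2 \<or> p dvd - 2"
      using cong[of i] ne assms(4) by (auto simp: offset_def split: if_splits)
    then show False using 2 by simp
  next
    case False
    show False
    proof (cases "even m = even m'")
      case True
      then have "p dvd int m - int m'"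
        using cong[of i] False by (auto simp: offset_def split: if_splits)
      then show False
        using small_dvd_eq[of p m m'] ne assms(2,3) by simp
    next
      case parity: False
      have "p dvd (offset i j m i - offset i j m' i) - (offset i j m j - offset i j m' j)"
        by (rule dvd_diff) (simp_all add: cong)
      then have "p dvd 2 \<or> p dvd - 2"
        using False parity by (auto simp: offset_def split: if_splits)
      then show False using 2 by simp
    qed
  qed
qed

text \<open>The paths from \<open>i\<close> to \<open>j\<close> and from \<open>j\<close> to
  \<open>i\<close> lie on one cycle. Exchanging the roles reverses the parity argument: equal
  parities make \<open>p\<close> divide 2, different ones force \<open>m = m'\<close>, which is
  absurd.\<close>

lemma offset_cong_swap:
  assumes "p > 2" "int m < p" "int m' < p" "i \<noteq> j"
    and cong: "\<And>c. c \<in> {i, j} \<Longrightarrow> p dvd offset i j m c - offset j i m' c"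
  shows False
proof (cases "even m = even m'")
  case True
  have "p dvd (offset i j m i - offset j i m' i) - (offset i j m j - offset j i m' j)"
    by (rule dvd_diff) (simp_all add: cong)
  then have "p dvd 2 \<or> p dvd - 2"
    using \<open>i \<noteq> j\<close> True by (auto simp: offset_def split: if_splits)
  then show False
    using \<open>p > 2\<close> zdvd_not_zless[of 2 p] by simp
next
  case False
  then have "p dvd int m - int m'"
    using cong[of i] \<open>i \<noteq> j\<close> by (auto simp: offset_def split: if_splits)
  then show False
    using small_dvd_eq[of p m m'] False assms(2,3) by auto
qed

text \<open>At an interior vertex the heights at \<open>i\<close> and \<open>j\<close> lie strictly
  between 0 and \<open>p\<close>. A path through it therefore has nonzero heights at both positions,
  so it runs between \<open>i\<close> and \<open>j\<close>; the opposite direction is excluded by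
  \<open>offset_cong_swap\<close>.\<close>

lemma offset_inner_unique:
  assumes "p > 2" "i \<noteq> j" "0 < m" "int m < p - 1" "int m' < p"
    and cong: "\<And>c. c \<in> {i, j} \<Longrightarrow> p dvd offset i j m c - offset i' j' m' c"
  shows "(i, j) = (i', j')"
proof -
  have nz: "offset i' j' m' c \<noteq> 0" if "c \<in> {i, j}" for c
  proof
    assume "offset i' j' m' c = 0"
    then have "p dvd offset i j m c"
      using cong[OF that] by simp
    moreover have "0 < offset i j m c" "offset i j m c < p"
      using assms that by (auto simp: offset_def)
    ultimately show False
      using zdvd_not_zless by blast
  qed
  have "c \<in> {i', j'}" if "c \<in> {i, j}" for c
    using nz[OF that] by (auto simp: offset_def split: if_splits)
  then have "i' = i \<and> j' = j \<or> i' = j \<and> j' = i"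
    using \<open>i \<noteq> j\<close> by auto
  moreover have "\<not> (i' = j \<and> j' = i)"
    using offset_cong_swap[of p m m' i j] assms by auto
  ultimately show ?thesis by auto
qed

section \<open>The nine paths in the Markoff graph\<close>

theorem theorem4p7:
  fixes \<kappa> p :: int
  assumes "\<kappa> \<noteq> 4"
    and "prime p" and "p > 3"
    and "Legendre (\<kappa> - 4) p = 1"
  shows "contains_subdivision_K33 (markoff_graph \<kappa> p)"
proof -
  have "p > 0" "p > 2" using \<open>p > 3\<close> by auto
  have "odd p"
    using prime_odd_int[OF \<open>prime p\<close>] \<open>p > 2\<close> by simp
  have qr: "QuadRes p (\<kappa> - 4)" "\<not> [\<kappa> - 4 = 0] (mod p)"
    using assms(4) by (auto simp: Legendre_def split: if_splits)
  then obtain d where d: "[d\<^sup>2 = \<kappa> - 4] (mod p)"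
    by (auto simp: QuadRes_def)
  \<comment> \<open>Makes \<open>d\<close> invertible modulo \<open>p\<close>, so that points are
    equal only if their heights are congruent.\<close>
  have "\<not> p dvd d"
  proof
    assume "p dvd d"
    then have "p dvd d\<^sup>2" by (simp add: power2_eq_square)
    then have "[d\<^sup>2 = 0] (mod p)" by (simp add: cong_0_iff)
    then show False using qr(2) d by (meson cong_sym cong_trans)
  qed
  note point_eq_iff = surface_point_eq_iff[OF \<open>prime p\<close> this]
  define D :: "nat set" where "D = {1, 2, 3}"
  define a where "a i = surface_point p d (\<lambda>c. if c = i then 1 else 0)" for i :: nat
  define b where "b j = surface_point p d (\<lambda>c. if c = j then -1 else 0)" for j :: nat
  define f where "f = (\<lambda>(i, j) m. surface_point p d (offset i j m))"
  define l :: "nat \<times> nat \<Rightarrow> nat \<Rightarrow> nat" where "l = (\<lambda>(i, j) m. if even m then j else i)"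
  \<comment> \<open>For \<open>i = j\<close> the path is the edge shared by two cycles; the other
    paths are the arcs of length \<open>p - 1\<close> left on the cycles.\<close>
  define n :: "nat \<times> nat \<Rightarrow> nat" where "n = (\<lambda>(i, j). if i = j then 1 else nat p - 1)"
  \<comment> \<open>Two different branch vertices have, at some position, heights differing by 1 or
    2 up to sign.\<close>
  have not_dvd: "\<not> p dvd 1" "\<not> p dvd 2"
    using \<open>p > 3\<close> zdvd_not_zless[of 1 p] zdvd_not_zless[of 2 p] by auto
  have bound: "int k < p" if "k \<le> n e" for e k
    using that \<open>p > 2\<close> by (auto simp: n_def split: if_splits prod.splits)
  have arcs: "arcs (markoff_graph \<kappa> p) = {(X, i, Y). X \<in> markoff_surface \<kappa> p \<and> i \<in> D \<and> Y = vieta p i X}"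
    by (simp add: markoff_graph_def D_def)
  have surf: "f e k \<in> markoff_surface \<kappa> p" if "e \<in> D \<times> D" for e k
    using that offset_in_markoff_surface[OF \<open>p > 0\<close> d, folded D_def] by (cases e) (simp add: f_def)
  have step: "vieta p (l e k) (f e k) = f e (Suc k)" if ek: "e \<in> D \<times> D" "k < n e" for e k
  proof -
    obtain i j where e: "e = (i, j)" by (cases e)
    have "i = j \<Longrightarrow> k = 0" using ek(2) by (simp add: e n_def)
    then show ?thesis
      using vieta_offset[of i j k p d, folded D_def] ek(1) by (simp add: e f_def l_def)
  qed
  have label: "l e k \<in> D" if "e \<in> D \<times> D" for e k
    using that by (auto simp: l_def)
  show ?thesis
  proof (rule contains_subdivision_K33I)
    interpret pseudo_graph "markoff_graph \<kappa> p"
      by (rule pseudo_graph_markoff_graph[OF \<open>p > 0\<close>])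
    show "wf_digraph (markoff_graph \<kappa> p)" by (rule wf_digraph)
    show "inj_on a D" "inj_on b D"
      using not_dvd by (auto simp: D_def inj_on_def a_def b_def point_eq_iff)
    show "a ` D \<inter> b ` D = {}"
      using not_dvd by (auto simp: D_def a_def b_def point_eq_iff)
    show "f (i, j) 0 = a i" if "i \<in> D" "j \<in> D" for i j
      by (auto simp: f_def a_def point_eq_iff offset_def)
    show "f (i, j) (n (i, j)) = b j" if "i \<in> D" "j \<in> D" for i j
    proof (cases "i = j")
      case True
      then show ?thesis by (auto simp: f_def b_def n_def point_eq_iff offset_def)
    next
      case False
      have N: "int (nat p - 1) = p - 1"
        using \<open>p > 0\<close> by simp
      have "even (p - 1)"
        using \<open>odd p\<close> by simp
      then have "even (nat p - 1)"
        by (simp only: N[symmetric] even_of_nat)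
      \<comment> \<open>At the even index \<open>p - 1\<close> the heights are \<open>p\<close> at
        \<open>i\<close> and \<open>p - 1\<close> at \<open>j\<close>, congruent to 0 and -1: this
        is the branch vertex \<open>b j\<close>.\<close>
      then have "offset i j (nat p - 1) = (\<lambda>c. if c = i then p else if c = j then p - 1 else 0)"
        using False unfolding offset_def N by (simp add: fun_eq_iff)
      then show ?thesis
        using False by (simp add: f_def b_def n_def point_eq_iff)
    qed
    show "inj_on (f e) {..n e}" if ije: "e \<in> D \<times> D" for e
    proof (rule inj_onI)
      fix k k' assume k: "k \<in> {..n e}" "k' \<in> {..n e}" "f e k = f e k'"
      obtain i j where e: "e = (i, j)" by (cases e)
      have "p dvd offset i j k c - offset i j k' c" if "c \<in> {i, j}" for c
        using k(3) that ije unfolding e f_def prod.case point_eq_iff D_def by auto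
      moreover have "i = j \<Longrightarrow> k \<le> 1 \<and> k' \<le> 1"
        using k by (simp add: e n_def)
      ultimately show "k = k'"
        using offset_cong_same[of p k k' i j] bound k \<open>p > 2\<close> by auto
    qed
    show "e = e'" if ek: "e \<in> D \<times> D" "e' \<in> D \<times> D"
      "0 < k" "k < n e" "k' \<le> n e'" "f e k = f e' k'" for e e' k k'
    proof -
      obtain i j i' j' where e: "e = (i, j)" "e' = (i', j')" by (cases e, cases e')
      have "i \<noteq> j" "int k < p - 1"
        using ek(3,4) \<open>p > 0\<close> by (auto simp: e n_def split: if_splits)
      moreover have "p dvd offset i j k c - offset i' j' k' c" if "c \<in> {i, j}" for c
        using ek(1,6) that unfolding e f_def prod.case point_eq_iff D_def by auto
      ultimately show ?thesis
        using offset_inner_unique[of p i j k k' i' j'] bound[OF ek(5)] \<open>p > 2\<close> \<open>0 < k\<close>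
        by (simp add: e)
    qed
    show "(f e k, l e k, f e (Suc k)) \<in> arcs (markoff_graph \<kappa> p)"
      if "e \<in> D \<times> D" "k < n e" for e k
      using surf[OF that(1)] label[OF that(1)] step[OF that] by (auto simp: arcs)
    \<comment> \<open>The same involution leads back, so the reverse arc bears the same
      label.\<close>
    show "(f e (Suc k), l e k, f e k) \<in> arcs (markoff_graph \<kappa> p)"
      if "e \<in> D \<times> D" "k < n e" for e k
      using surf[OF that(1)] label[OF that(1)] vieta_vieta[OF surf[OF that(1)], of "l e k" k] step[OF that]
      by (auto simp: arcs)
  qed (simp_all add: markoff_graph_def D_def)
qed

end
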